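(* Let $k$ be a field and let $\mathcal{C}$ be a category equipped with a faithful conservative functor $|\cdot|\colon\mathcal{C}\to\mathbf{FI}$. Suppose the following two conditions hold: (a) The category $\mathcal{C}$ is orderable, i.e., it is possible to assign to each finite set $|A|$ (for $A$ an object of $\mathcal{C}$) a total order such that for each morphism $\phi\colon A\to B$ of $\mathcal{C}$ the function $|\phi|\colon |A|\to|B|$ is order preserving. (b) The poset $\mathcal{M}(\mathcal{C})$ consisting of isomorphism classes of weighted objects in $\mathcal{C}$ is a well-quasi-order. Then $R$ is noetherian.
   Context: $\mathbf{FI}$ is the category of finite sets and injections. A functor is conservative if it reflects isomorphisms. For an object $A$ of $\mathcal{C}$, $R_A=k[x_i]_{i\in|A|}$ is the polynomial ring; a morphism $\phi\colon A\to B$ induces a $k$-algebra homomorphism $\phi_*\colon R_A\to R_B$, $\phi_*(x_i)=x_{\phi(i)}$ (where $\phi(i)$ means $|\phi|(i)$); thus $R$ is a functor from $\mathcal{C}$ to $k$-algebras. An ideal system of $R$ is a rule assigning to each object $A$ an ideal $I_A$ of $R_A$ such that $\phi_*(I_A)\subset I_B$ for every morphism $\phi\colon A\to B$. For ideal systems $I,J$, write $I\subset J$ if $I_A\subset J_A$ for all $A$. $R$ is noetherian if ideal systems satisfy the ascending chain condition. A weighting on $A$ is a function $\alpha\colon|A|\to\mathbf{N}$ (with $0\in\mathbf{N}$). A weighted object is a pair $(A,\alpha)$ with $\alpha$ a weighting on $A$; a morphism $(A,\alpha)\to(B,\beta)$ is a morphism $\phi\colon A\to B$ in $\mathcal{C}$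 with $\alpha(x)\le\beta(\phi(x))$ for all $x\in|A|$. $\mathcal{M}(\mathcal{C})$ is the set of isomorphism classes $[A,\alpha]$ of weighted objects, partially ordered by $[A,\alpha]\le[B,\beta]$ if there is a morphism $(A,\alpha)\to(B,\beta)$. A poset is a well-quasi-order (wqo) if for every infinite sequence $x_1,x_2,\ldots$ in it there are $i<j$ with $x_i\le x_j$. *)

theory Defs
  imports "HOL-Algebra.Ideal" "HOL-Algebra.RingHom" "HOL-Library.Poly_Mapping" "HOL-Library.FuncSet"
begin

section \<open>Categories and functors\<close>

text \<open>\<open>Comp C g f\<close> is the composite \<open>g \<circ> f\<close>; it is only meaningful when \<open>Cod C f = Dom C g\<close>.\<close>

record ('o, 'm) cat =
  Obj :: "'o set"
  Arr :: "'m set"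
  Dom :: "'m \<Rightarrow> 'o"
  Cod :: "'m \<Rightarrow> 'o"
  Ident :: "'o \<Rightarrow> 'm"
  Comp :: "'m \<Rightarrow> 'm \<Rightarrow> 'm"

locale category =
  fixes C :: "('o, 'm) cat"
  assumes Dom_Obj: "f \<in> Arr C \<Longrightarrow> Dom C f \<in> Obj C"
    and Cod_Obj: "f \<in> Arr C \<Longrightarrow> Cod C f \<in> Obj C"
    and Ident_Arr: "A \<in> Obj C \<Longrightarrow> Ident C A \<in> Arr C"
    and Dom_Ident: "A \<in> Obj C \<Longrightarrow> Dom C (Ident C A) = A"
    and Cod_Ident: "A \<in> Obj C \<Longrightarrow> Cod C (Ident C A) = A"
    and Comp_Arr: "\<lbrakk>f \<in> Arr C; g \<in> Arr C; Cod C f = Dom C g\<rbrakk> \<Longrightarrow> Comp C g f \<in> Arr C"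
    and Dom_Comp: "\<lbrakk>f \<in> Arr C; g \<in> Arr C; Cod C f = Dom C g\<rbrakk> \<Longrightarrow> Dom C (Comp C g f) = Dom C f"
    and Cod_Comp: "\<lbrakk>f \<in> Arr C; g \<in> Arr C; Cod C f = Dom C g\<rbrakk> \<Longrightarrow> Cod C (Comp C g f) = Cod C g"
    and Comp_Ident_right: "f \<in> Arr C \<Longrightarrow> Comp C f (Ident C (Dom C f)) = f"
    and Comp_Ident_left: "f \<in> Arr C \<Longrightarrow> Comp C (Ident C (Cod C f)) f = f"
    and Comp_assoc: "\<lbrakk>f \<in> Arr C; g \<in> Arr C; h \<in> Arr C; Cod C f = Dom C g; Cod C g = Dom C h\<rbrakk>
      \<Longrightarrow> Comp C h (Comp C g f) = Comp C (Comp C h g) f"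

definition is_iso :: "('o, 'm) cat \<Rightarrow> 'm \<Rightarrow> bool" where
  "is_iso C f \<longleftrightarrow> f \<in> Arr C \<and>
     (\<exists>g \<in> Arr C. Dom C g = Cod C f \<and> Cod C g = Dom C f \<and>
        Comp C g f = Ident C (Dom C f) \<and> Comp C f g = Ident C (Cod C f))"

definition isomorphic :: "('o, 'm) cat \<Rightarrow> 'o \<Rightarrow> 'o \<Rightarrow> bool" where
  "isomorphic C A B \<longleftrightarrow> (\<exists>f. is_iso C f \<and> Dom C f = A \<and> Cod C f = B)"

locale cat_functor = C: category C + D: category D
  for C :: "('o, 'm) cat" and D :: "('p, 'n) cat" +
  fixes Fo :: "'o \<Rightarrow> 'p" and Fa :: "'m \<Rightarrow> 'n"
  assumes Fo_Obj: "A \<in> Obj C \<Longrightarrow> Fo A \<in> Obj D"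
    and Fa_Arr: "f \<in> Arr C \<Longrightarrow> Fa f \<in> Arr D"
    and Dom_Fa: "f \<in> Arr C \<Longrightarrow> Dom D (Fa f) = Fo (Dom C f)"
    and Cod_Fa: "f \<in> Arr C \<Longrightarrow> Cod D (Fa f) = Fo (Cod C f)"
    and Fa_Ident: "A \<in> Obj C \<Longrightarrow> Fa (Ident C A) = Ident D (Fo A)"
    and Fa_Comp: "\<lbrakk>f \<in> Arr C; g \<in> Arr C; Cod C f = Dom C g\<rbrakk>
      \<Longrightarrow> Fa (Comp C g f) = Comp D (Fa g) (Fa f)"

definition faithful :: "('o, 'm) cat \<Rightarrow> ('m \<Rightarrow> 'n) \<Rightarrow> bool" where
  "faithful C Fa \<longleftrightarrow> (\<forall>f \<in> Arr C. \<forall>g \<in> Arr C.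
     Dom C f = Dom C g \<and> Cod C f = Cod C g \<and> Fa f = Fa g \<longrightarrow> f = g)"

definition conservative :: "('o, 'm) cat \<Rightarrow> ('p, 'n) cat \<Rightarrow> ('m \<Rightarrow> 'n) \<Rightarrow> bool" where
  "conservative C D Fa \<longleftrightarrow> (\<forall>f \<in> Arr C. is_iso D (Fa f) \<longrightarrow> is_iso C f)"

section \<open>Finite sets and injections\<close>

text \<open>The objects are the finite sets of elements of a type \<open>'x\<close>. The function carried by an
  arrow is \<open>undefined\<close> outside its domain, so that equal arrows are equal functions on the domain.\<close>

datatype 'x fi_arrow = FI_Arrow (fi_dom: "'x set") (fi_fun: "'x \<Rightarrow> 'x") (fi_cod: "'x set")

definition FI :: "('x set, 'x fi_arrow) cat" where
  "FI = \<lparr> Obj = {S. finite S},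
     Arr = {FI_Arrow S f T | S f T. finite S \<and> finite T \<and> f \<in> S \<rightarrow>\<^sub>E T \<and> inj_on f S},
     Dom = fi_dom,
     Cod = fi_cod,
     Ident = (\<lambda>S. FI_Arrow S (\<lambda>x\<in>S. x) S),
     Comp = (\<lambda>g f. FI_Arrow (fi_dom f) (compose (fi_dom f) (fi_fun g) (fi_fun f)) (fi_cod g)) \<rparr>"

lemma FI_sel:
  "Obj FI = {S. finite S}"
  "Arr FI = {FI_Arrow S f T | S f T. finite S \<and> finite T \<and> f \<in> S \<rightarrow>\<^sub>E T \<and> inj_on f S}"
  "Dom FI = fi_dom" "Cod FI = fi_cod"
  "Ident FI = (\<lambda>S. FI_Arrow S (\<lambda>x\<in>S. x) S)"
  "Comp FI = (\<lambda>g f. FI_Arrow (fi_dom f) (compose (fi_dom f) (fi_fun g) (fi_fun f)) (fi_cod g))"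
  by (simp_all add: FI_def)

lemma category_FI: "category FI"
proof
  fix f g :: "'x fi_arrow"
  assume fg: "f \<in> Arr FI" "g \<in> Arr FI" "Cod FI f = Dom FI g"
  have inj: "inj_on (compose (fi_dom f) (fi_fun g) (fi_fun f)) (fi_dom f)"
    using fg by (fastforce simp: FI_sel inj_on_def compose_def PiE_def Pi_def)
  show "Comp FI g f \<in> Arr FI"
    using fg inj by (fastforce simp: FI_sel compose_def)
next
  fix f g h :: "'x fi_arrow"
  assume "f \<in> Arr FI" "g \<in> Arr FI" "h \<in> Arr FI" "Cod FI f = Dom FI g" "Cod FI g = Dom FI h"
  then show "Comp FI h (Comp FI g f) = Comp FI (Comp FI h g) f"
    by (auto simp: FI_sel compose_def fun_eq_iff restrict_def PiE_def Pi_def)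
next
  fix S :: "'x set"
  assume "S \<in> Obj FI"
  then have "finite S" "(\<lambda>x\<in>S. x) \<in> S \<rightarrow>\<^sub>E S" "inj_on (\<lambda>x\<in>S. x) S"
    by (auto simp: FI_sel inj_on_def)
  then show "Ident FI S \<in> Arr FI"
    unfolding FI_sel by blast
qed (auto simp: FI_sel compose_def fun_eq_iff restrict_def PiE_def Pi_def extensional_def inj_on_def)

section \<open>Polynomial rings\<close>

text \<open>\<open>('x \<Rightarrow>\<^sub>0 nat) \<Rightarrow>\<^sub>0 'k\<close> is the polynomial ring over \<open>'k\<close> in the variables \<open>'x\<close>: exponent
  vectors are elements of \<open>'x \<Rightarrow>\<^sub>0 nat\<close> and multiplication is convolution.\<close>

type_synonym ('x, 'k) mpoly = "('x \<Rightarrow>\<^sub>0 nat) \<Rightarrow>\<^sub>0 'k"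

definition pconst :: "'k \<Rightarrow> ('x, 'k::comm_ring_1) mpoly" where
  "pconst c = Poly_Mapping.single 0 c"

definition pvar :: "'x \<Rightarrow> ('x, 'k::comm_ring_1) mpoly" where
  "pvar i = Poly_Mapping.single (Poly_Mapping.single i 1) 1"

definition poly_ring :: "'x set \<Rightarrow> ('x, 'k::comm_ring_1) mpoly ring" where
  "poly_ring S = \<lparr> carrier = {p. \<forall>m \<in> Poly_Mapping.keys p. Poly_Mapping.keys m \<subseteq> S},
     mult = (*), one = 1, zero = 0, add = (+) \<rparr>"

text \<open>The \<open>'k\<close>-algebra homomorphism sending each variable \<open>i\<close> to the variable \<open>f i\<close>.\<close>

definition rename_vars :: "('x \<Rightarrow> 'x) \<Rightarrow> ('x, 'k::comm_ring_1) mpoly \<Rightarrow> ('x, 'k) mpoly" where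
  "rename_vars f p = (\<Sum>m \<in> Poly_Mapping.keys p. pconst (Poly_Mapping.lookup p m) *
     (\<Prod>i \<in> Poly_Mapping.keys m. pvar (f i) ^ Poly_Mapping.lookup m i))"

lemma poly_ring_sel:
  "carrier (poly_ring S) = {p. \<forall>m \<in> Poly_Mapping.keys p. Poly_Mapping.keys m \<subseteq> S}"
  "mult (poly_ring S) = (*)" "one (poly_ring S) = 1"
  "zero (poly_ring S) = 0" "add (poly_ring S) = (+)"
  by (simp_all add: poly_ring_def)

lemma mult_closed:
  assumes "p \<in> carrier (poly_ring S)" "q \<in> carrier (poly_ring S)"
  shows "p * q \<in> carrier (poly_ring S)"
proof -
  have "Poly_Mapping.keys m \<subseteq> S" if m: "m \<in> Poly_Mapping.keys (p * q)" for m
  proof -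
    obtain a b where ab: "m = a + b" "a \<in> Poly_Mapping.keys p" "b \<in> Poly_Mapping.keys q"
      using subsetD[OF keys_mult m] by blast
    then show ?thesis using assms keys_add[of a b] unfolding poly_ring_sel by blast
  qed
  then show ?thesis by (auto simp: poly_ring_sel)
qed

lemma add_closed:
  assumes "p \<in> carrier (poly_ring S)" "q \<in> carrier (poly_ring S)"
  shows "p + q \<in> carrier (poly_ring S)"
  using assms keys_add[of p q] by (fastforce simp: poly_ring_sel)

lemma cring_poly_ring:
  fixes S :: "'x set"
  shows "cring (poly_ring S :: ('x, 'k::comm_ring_1) mpoly ring)"
proof (rule cringI)
  show "abelian_group (poly_ring S :: ('x, 'k) mpoly ring)"
  proof (rule abelian_groupI)
    fix p :: "('x, 'k) mpoly"
    assume "p \<in> carrier (poly_ring S)"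
    then have "- p \<in> carrier (poly_ring S)" "- p + p = 0"
      by (simp_all add: poly_ring_sel in_keys_iff)
    then show "\<exists>y\<in>carrier (poly_ring S). y \<oplus>\<^bsub>poly_ring S\<^esub> p = \<zero>\<^bsub>poly_ring S\<^esub>"
      by (force simp: poly_ring_sel(4,5))
  qed (simp_all add: poly_ring_sel(2-5) add_closed add.assoc add.commute, simp add: poly_ring_sel)
  show "comm_monoid (poly_ring S :: ('x, 'k) mpoly ring)"
    by (rule comm_monoidI)
       (simp_all add: poly_ring_sel(2-5) mult_closed mult.assoc mult.commute, simp add: poly_ring_sel)
qed (simp add: poly_ring_sel(2-5) distrib_right)

lemma rename_vars_add: "rename_vars f (p + q) = rename_vars f p + rename_vars f q"
  unfolding rename_vars_def
  by (rule setsum_keys_plus_distrib) (simp_all add: pconst_def single_add distrib_right)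

definition rename_mon :: "('x \<Rightarrow> 'x) \<Rightarrow> ('x \<Rightarrow>\<^sub>0 nat) \<Rightarrow> ('x, 'k::comm_ring_1) mpoly" where
  "rename_mon f m = (\<Prod>i \<in> Poly_Mapping.keys m. pvar (f i) ^ Poly_Mapping.lookup m i)"

lemma rename_mon_superset:
  assumes "finite S" "Poly_Mapping.keys m \<subseteq> S"
  shows "rename_mon f m = (\<Prod>i \<in> S. pvar (f i) ^ Poly_Mapping.lookup m i)"
  unfolding rename_mon_def using assms
  by (intro prod.mono_neutral_left) (auto simp: in_keys_iff)

lemma rename_mon_add: "rename_mon f (m + n) = rename_mon f m * rename_mon f n"
proof -
  let ?S = "Poly_Mapping.keys m \<union> Poly_Mapping.keys n"
  have "rename_mon f (m + n) = (\<Prod>i \<in> ?S. pvar (f i) ^ Poly_Mapping.lookup (m + n) i)"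
    using keys_add[of m n] by (intro rename_mon_superset) auto
  also have "\<dots> = (\<Prod>i \<in> ?S. pvar (f i) ^ Poly_Mapping.lookup m i) *
                 (\<Prod>i \<in> ?S. pvar (f i) ^ Poly_Mapping.lookup n i)"
    by (simp add: lookup_add power_add prod.distrib)
  also have "\<dots> = rename_mon f m * rename_mon f n"
    by (simp add: rename_mon_superset[symmetric])
  finally show ?thesis .
qed

lemma rename_vars_single: "rename_vars f (Poly_Mapping.single m c) = pconst c * rename_mon f m"
  by (cases "c = 0") (simp_all add: rename_vars_def rename_mon_def pconst_def)

lemma rename_vars_0: "rename_vars f 0 = 0"
  by (simp add: rename_vars_def)

lemma rename_vars_sum: "rename_vars f (\<Sum>x\<in>T. h x) = (\<Sum>x\<in>T. rename_vars f (h x))"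
  by (induction T rule: infinite_finite_induct) (simp_all add: rename_vars_0 rename_vars_add)

lemma mpoly_expand:
  "p = (\<Sum>m \<in> Poly_Mapping.keys p. Poly_Mapping.single m (Poly_Mapping.lookup p m))"
  by (rule poly_mapping_eqI)
     (auto simp: lookup_sum lookup_single when_def sum.delta' in_keys_iff)

lemma rename_vars_mult: "rename_vars f (p * q) = rename_vars f p * rename_vars f q"
proof -
  let ?s = "\<lambda>p m. Poly_Mapping.single m (Poly_Mapping.lookup p m)"
  have "rename_vars f (p * q) =
    rename_vars f ((\<Sum>m \<in> Poly_Mapping.keys p. ?s p m) * (\<Sum>n \<in> Poly_Mapping.keys q. ?s q n))"
    by (simp only: mpoly_expand[symmetric])
  also have "\<dots> = (\<Sum>m \<in> Poly_Mapping.keys p. \<Sum>n \<in> Poly_Mapping.keys q.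
       rename_vars f (?s p m) * rename_vars f (?s q n))"
    by (simp add: sum_product rename_vars_sum mult_single rename_vars_single rename_mon_add
          pconst_def mult_ac flip: mult_single[of 0 _ 0, simplified])
  also have "\<dots> = (\<Sum>m \<in> Poly_Mapping.keys p. rename_vars f (?s p m)) *
                  (\<Sum>n \<in> Poly_Mapping.keys q. rename_vars f (?s q n))"
    by (simp add: sum_product)
  also have "\<dots> = rename_vars f p * rename_vars f q"
    by (simp only: rename_vars_sum[symmetric] mpoly_expand[symmetric])
  finally show ?thesis .
qed

lemma rename_vars_pconst: "rename_vars f (pconst c) = pconst c"
  by (simp add: pconst_def rename_vars_single rename_mon_def)

lemma rename_vars_pvar: "rename_vars f (pvar i) = pvar (f i)"
  by (simp add: pvar_def[of i] rename_vars_single rename_mon_def pconst_def)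

lemma rename_vars_1: "rename_vars f 1 = 1"
  using rename_vars_pconst[of f 1] by (simp add: pconst_def)

lemma sum_closed:
  "(\<And>x. x \<in> T \<Longrightarrow> h x \<in> carrier (poly_ring S)) \<Longrightarrow> (\<Sum>x\<in>T. h x) \<in> carrier (poly_ring S)"
proof (induction T rule: infinite_finite_induct)
  case (insert x F)
  then show ?case by (simp add: add_closed)
qed (simp_all add: poly_ring_sel)

lemma prod_closed:
  "(\<And>x. x \<in> T \<Longrightarrow> h x \<in> carrier (poly_ring S)) \<Longrightarrow> (\<Prod>x\<in>T. h x) \<in> carrier (poly_ring S)"
proof (induction T rule: infinite_finite_induct)
  case (insert x F)
  then show ?case by (simp add: mult_closed)
qed (simp_all add: poly_ring_sel)

lemma power_closed: "p \<in> carrier (poly_ring S) \<Longrightarrow> p ^ n \<in> carrier (poly_ring S)"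
  by (induction n) (simp_all add: mult_closed, simp add: poly_ring_sel)

lemma rename_vars_ring_hom:
  fixes S T :: "'x set"
  assumes "f ` S \<subseteq> T"
  shows "(rename_vars f :: ('x, 'k::comm_ring_1) mpoly \<Rightarrow> _) \<in> ring_hom (poly_ring S) (poly_ring T)"
proof (rule ring_hom_memI)
  fix p :: "('x, 'k) mpoly"
  assume p: "p \<in> carrier (poly_ring S)"
  show "rename_vars f p \<in> carrier (poly_ring T)"
    unfolding rename_vars_def
  proof (intro sum_closed mult_closed prod_closed power_closed)
    fix m i assume "m \<in> Poly_Mapping.keys p" "i \<in> Poly_Mapping.keys m"
    then have "f i \<in> T" using p assms by (auto simp: poly_ring_sel)
    then show "pvar (f i) \<in> carrier (poly_ring T)"
      by (simp add: poly_ring_sel pvar_def)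
  next
    fix m show "pconst (Poly_Mapping.lookup p m) \<in> carrier (poly_ring T)"
      by (simp add: poly_ring_sel pconst_def)
  qed
qed (simp_all add: poly_ring_sel(2-5) rename_vars_add rename_vars_mult rename_vars_1)

section \<open>Ideal systems\<close>

definition ideal_system ::
  "('o, 'm) cat \<Rightarrow> ('o \<Rightarrow> 'r ring) \<Rightarrow> ('m \<Rightarrow> 'r \<Rightarrow> 'r) \<Rightarrow> ('o \<Rightarrow> 'r set) \<Rightarrow> bool" where
  "ideal_system C R Rmap I \<longleftrightarrow>
     (\<forall>A \<in> Obj C. ideal (I A) (R A)) \<and>
     (\<forall>\<phi> \<in> Arr C. Rmap \<phi> ` I (Dom C \<phi>) \<subseteq> I (Cod C \<phi>))"

definition noetherian ::
  "('o, 'm) cat \<Rightarrow> ('o \<Rightarrow> 'r ring) \<Rightarrow> ('m \<Rightarrow> 'r \<Rightarrow> 'r) \<Rightarrow> bool" where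
  "noetherian C R Rmap \<longleftrightarrow>
     (\<forall>I :: nat \<Rightarrow> 'o \<Rightarrow> 'r set.
        (\<forall>n. ideal_system C R Rmap (I n)) \<and> (\<forall>n. \<forall>A \<in> Obj C. I n A \<subseteq> I (Suc n) A)
        \<longrightarrow> (\<exists>N. \<forall>n \<ge> N. \<forall>A \<in> Obj C. I n A = I N A))"

text \<open>The two parts of the functor \<open>R\<close>, for a functor \<open>(Fo, Fa)\<close> to \<open>FI\<close>.\<close>

definition R_obj :: "('o \<Rightarrow> 'x set) \<Rightarrow> 'o \<Rightarrow> ('x, 'k::comm_ring_1) mpoly ring" where
  "R_obj Fo A = poly_ring (Fo A)"

definition R_map :: "('m \<Rightarrow> 'x fi_arrow) \<Rightarrow> 'm \<Rightarrow> ('x, 'k::comm_ring_1) mpoly \<Rightarrow> ('x, 'k) mpoly" where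
  "R_map Fa \<phi> = rename_vars (fi_fun (Fa \<phi>))"

section \<open>Orderability\<close>

definition orderable ::
  "('o, 'm) cat \<Rightarrow> ('o \<Rightarrow> 'x set) \<Rightarrow> ('m \<Rightarrow> 'x fi_arrow) \<Rightarrow> bool" where
  "orderable C Fo Fa \<longleftrightarrow>
     (\<exists>L :: 'o \<Rightarrow> 'x rel.
        (\<forall>A \<in> Obj C. linear_order_on (Fo A) (L A)) \<and>
        (\<forall>\<phi> \<in> Arr C. \<forall>x y. (x, y) \<in> L (Dom C \<phi>) \<longrightarrow>
           (fi_fun (Fa \<phi>) x, fi_fun (Fa \<phi>) y) \<in> L (Cod C \<phi>)))"

section \<open>Weighted objects\<close>

text \<open>An arrow of the category of weighted objects is a triple consisting of its domain, the
  underlying arrow of \<open>C\<close> and its codomain.\<close>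

type_synonym ('o, 'x) wobj = "'o \<times> ('x \<Rightarrow> nat)"

definition weighted_cat ::
  "('o, 'm) cat \<Rightarrow> ('o \<Rightarrow> 'x set) \<Rightarrow> ('m \<Rightarrow> 'x fi_arrow)
     \<Rightarrow> (('o, 'x) wobj, ('o, 'x) wobj \<times> 'm \<times> ('o, 'x) wobj) cat" where
  "weighted_cat C Fo Fa =
     (let W = {(A, \<alpha>). A \<in> Obj C \<and> \<alpha> \<in> Fo A \<rightarrow>\<^sub>E (UNIV :: nat set)} in
      \<lparr> Obj = W,
        Arr = {((A, \<alpha>), \<phi>, (B, \<beta>)) | A \<alpha> \<phi> B \<beta>.
          (A, \<alpha>) \<in> W \<and> (B, \<beta>) \<in> W \<and> \<phi> \<in> Arr C \<and> Dom C \<phi> = A \<and> Cod C \<phi> = B \<and>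
          (\<forall>x \<in> Fo A. \<alpha> x \<le> \<beta> (fi_fun (Fa \<phi>) x))},
        Dom = (\<lambda>(a, \<phi>, b). a),
        Cod = (\<lambda>(a, \<phi>, b). b),
        Ident = (\<lambda>a. (a, Ident C (fst a), a)),
        Comp = (\<lambda>(b, \<psi>, c) (a, \<phi>, b'). (a, Comp C \<psi> \<phi>, c)) \<rparr>)"

definition iso_classes :: "('o, 'm) cat \<Rightarrow> 'o set set" where
  "iso_classes C = Obj C // {(A, B). A \<in> Obj C \<and> B \<in> Obj C \<and> isomorphic C A B}"

definition class_le :: "('o, 'm) cat \<Rightarrow> 'o set \<Rightarrow> 'o set \<Rightarrow> bool" where
  "class_le C X Y \<longleftrightarrow> (\<exists>A \<in> X. \<exists>B \<in> Y. \<exists>f \<in> Arr C. Dom C f = A \<and> Cod C f = B)"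

definition wqo_on :: "'a set \<Rightarrow> ('a \<Rightarrow> 'a \<Rightarrow> bool) \<Rightarrow> bool" where
  "wqo_on S r \<longleftrightarrow>
     (\<forall>x :: nat \<Rightarrow> 'a. (\<forall>n. x n \<in> S) \<longrightarrow> (\<exists>i j. i < j \<and> r (x i) (x j)))"

lemma weighted_cat_sel:
  "Obj (weighted_cat C Fo Fa) = {(A, \<alpha>). A \<in> Obj C \<and> \<alpha> \<in> Fo A \<rightarrow>\<^sub>E (UNIV :: nat set)}"
  "(a, \<phi>, b) \<in> Arr (weighted_cat C Fo Fa) \<longleftrightarrow>
     a \<in> Obj (weighted_cat C Fo Fa) \<and> b \<in> Obj (weighted_cat C Fo Fa) \<and>
     \<phi> \<in> Arr C \<and> Dom C \<phi> = fst a \<and> Cod C \<phi> = fst b \<and>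
     (\<forall>x \<in> Fo (fst a). snd a x \<le> snd b (fi_fun (Fa \<phi>) x))"
  "Dom (weighted_cat C Fo Fa) (a, \<phi>, b) = a"
  "Cod (weighted_cat C Fo Fa) (a, \<phi>, b) = b"
  "Ident (weighted_cat C Fo Fa) a = (a, Ident C (fst a), a)"
  "Comp (weighted_cat C Fo Fa) (b, \<psi>, c) (a, \<phi>, b') = (a, Comp C \<psi> \<phi>, c)"
  by (cases a; cases b; auto simp: weighted_cat_def Let_def)+

lemma category_weighted_cat:
  assumes "cat_functor C FI Fo Fa"
  shows "category (weighted_cat C Fo Fa)"
proof -
  interpret cat_functor C FI Fo Fa by fact
  have fun_Ident: "fi_fun (Fa (Ident C A)) x = x" if "A \<in> Obj C" "x \<in> Fo A" for A x
    using that by (simp add: Fa_Ident FI_sel)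
  have dom: "fi_dom (Fa f) = Fo (Dom C f)" "fi_cod (Fa f) = Fo (Cod C f)" if "f \<in> Arr C" for f
    using Dom_Fa[OF that] Cod_Fa[OF that] by (simp_all add: FI_sel)
  have maps: "fi_fun (Fa f) x \<in> Fo (Cod C f)" if "f \<in> Arr C" "x \<in> Fo (Dom C f)" for f x
    using Fa_Arr[OF that(1)] that(2) dom[OF that(1)] by (auto simp: FI_sel)
  have fun_Comp: "fi_fun (Fa (Comp C g f)) x = fi_fun (Fa g) (fi_fun (Fa f) x)"
    if "f \<in> Arr C" "g \<in> Arr C" "Cod C f = Dom C g" "x \<in> Fo (Dom C f)" for f g x
    using that by (simp add: Fa_Comp FI_sel dom compose_def)
  show ?thesis
  proof (unfold_locales, goal_cases)
    case (6 f g)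
    then show ?case
      by (cases f; cases g)
         (fastforce simp: weighted_cat_sel C.Comp_Arr C.Dom_Comp C.Cod_Comp fun_Comp maps
            intro: order_trans)
  qed (auto simp: weighted_cat_sel split_paired_all C.Ident_Arr C.Dom_Ident C.Cod_Ident fun_Ident
         C.Comp_assoc C.Comp_Ident_left C.Comp_Ident_right)
qed

context category
begin

lemma isomorphic_refl: "A \<in> Obj C \<Longrightarrow> isomorphic C A A"
  unfolding isomorphic_def is_iso_def
  by (rule exI[of _ "Ident C A"])
     (metis Cod_Ident Comp_Ident_left Dom_Ident Ident_Arr)

lemma isomorphic_sym: "isomorphic C A B \<Longrightarrow> isomorphic C B A"
  unfolding isomorphic_def is_iso_def by metis

lemma is_iso_Comp:
  assumes "is_iso C f" "is_iso C g" "Cod C f = Dom C g"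
  shows "is_iso C (Comp C g f)"
proof -
  obtain f' where f: "f \<in> Arr C" "f' \<in> Arr C" "Dom C f' = Cod C f" "Cod C f' = Dom C f"
      "Comp C f' f = Ident C (Dom C f)" "Comp C f f' = Ident C (Cod C f)"
    using assms(1) unfolding is_iso_def by blast
  obtain g' where g: "g \<in> Arr C" "g' \<in> Arr C" "Dom C g' = Cod C g" "Cod C g' = Dom C g"
      "Comp C g' g = Ident C (Dom C g)" "Comp C g g' = Ident C (Cod C g)"
    using assms(2) unfolding is_iso_def by blast
  have 1: "Comp C (Comp C f' g') (Comp C g f) = Ident C (Dom C f)"
    using f g assms(3) by (metis Comp_Arr Comp_Ident_left Comp_assoc Cod_Comp Dom_Comp)
  have 2: "Comp C (Comp C g f) (Comp C f' g') = Ident C (Cod C g)"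
    using f g assms(3) by (metis Comp_Arr Comp_Ident_left Comp_assoc Cod_Comp Dom_Comp)
  show ?thesis
    unfolding is_iso_def using 1 2 f g assms(3)
    by (intro conjI bexI[of _ "Comp C f' g'"]) (simp_all add: Comp_Arr Dom_Comp Cod_Comp)
qed

lemma isomorphic_trans: "isomorphic C A B \<Longrightarrow> isomorphic C B D \<Longrightarrow> isomorphic C A D"
  unfolding isomorphic_def
  by (metis is_iso_Comp is_iso_def Dom_Comp Cod_Comp)

lemma equiv_isomorphic: "equiv (Obj C) {(A, B). A \<in> Obj C \<and> B \<in> Obj C \<and> isomorphic C A B}"
  by (rule equivI)
     (auto simp: refl_on_def sym_def trans_def intro: isomorphic_refl isomorphic_sym isomorphic_trans)

lemma iso_classes_partial_order:
  assumes antisym: "\<And>f g. \<lbrakk>f \<in> Arr C; g \<in> Arr C; Dom C g = Cod C f; Cod C g = Dom C f\<rbrakk> \<Longrightarrow> is_iso C f"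
  shows "partial_order_on (iso_classes C)
    {(X, Y). X \<in> iso_classes C \<and> Y \<in> iso_classes C \<and> class_le C X Y}"
proof -
  let ?r = "{(A, B). A \<in> Obj C \<and> B \<in> Obj C \<and> isomorphic C A B}"
  have iso: "A \<in> Obj C \<and> B \<in> Obj C \<and> isomorphic C A B" if "X \<in> iso_classes C" "A \<in> X" "B \<in> X" for X A B
    using in_quotient_imp_in_rel[OF equiv_isomorphic, of X A B] that
    unfolding iso_classes_def by auto
  have ne: "\<exists>A. A \<in> X" if "X \<in> iso_classes C" for X
    using in_quotient_imp_non_empty[OF equiv_isomorphic] that unfolding iso_classes_def by blast
  have refl: "class_le C X X" if "X \<in> iso_classes C" for X
    using ne[OF that] iso[OF that] unfolding class_le_def isomorphic_def is_iso_def by metis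
  have trans: "class_le C X Z"
    if Y: "Y \<in> iso_classes C" and le: "class_le C X Y" "class_le C Y Z" for X Y Z
  proof -
    obtain f where f: "f \<in> Arr C" "Dom C f \<in> X" "Cod C f \<in> Y"
      using le(1) unfolding class_le_def by blast
    obtain g where g: "g \<in> Arr C" "Dom C g \<in> Y" "Cod C g \<in> Z"
      using le(2) unfolding class_le_def by blast
    obtain h where h: "h \<in> Arr C" "Dom C h = Cod C f" "Cod C h = Dom C g"
      using iso[OF Y f(3) g(2)] unfolding isomorphic_def is_iso_def by blast
    have "Comp C g (Comp C h f) \<in> Arr C" "Dom C (Comp C g (Comp C h f)) = Dom C f"
      "Cod C (Comp C g (Comp C h f)) = Cod C g"
      using f g h by (simp_all add: Comp_Arr Dom_Comp Cod_Comp)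
    then show ?thesis
      using f g unfolding class_le_def by metis
  qed
  have asym: "X = Y"
    if X: "X \<in> iso_classes C" and Y: "Y \<in> iso_classes C" and le: "class_le C X Y" "class_le C Y X" for X Y
  proof -
    obtain f where f: "f \<in> Arr C" "Dom C f \<in> X" "Cod C f \<in> Y"
      using le(1) unfolding class_le_def by blast
    obtain g where g: "g \<in> Arr C" "Dom C g \<in> Y" "Cod C g \<in> X"
      using le(2) unfolding class_le_def by blast
    obtain h where h: "h \<in> Arr C" "Dom C h = Cod C f" "Cod C h = Dom C g"
      using iso[OF Y f(3) g(2)] unfolding isomorphic_def is_iso_def by blast
    obtain k where k: "k \<in> Arr C" "Dom C k = Cod C g" "Cod C k = Dom C f"
      using iso[OF X g(3) f(2)] unfolding isomorphic_def is_iso_def by blast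
    have "is_iso C f"
      by (rule antisym[of f "Comp C k (Comp C g h)"])
         (use f g h k in \<open>simp_all add: Comp_Arr Dom_Comp Cod_Comp\<close>)
    then have "(Dom C f, Cod C f) \<in> ?r"
      using f Dom_Obj Cod_Obj by (auto simp: isomorphic_def)
    then show ?thesis
      using X Y f quotient_eqI[OF equiv_isomorphic, of X Y "Dom C f" "Cod C f"]
      unfolding iso_classes_def by blast
  qed
  show ?thesis
    unfolding partial_order_on_def preorder_on_def
    by (intro conjI refl_onI transI antisymI) (use refl trans asym in blast)+
qed

end

text \<open>The order on isomorphism classes of weighted objects is antisymmetric because the underlying
  sets are finite and the functor is conservative.\<close>

lemma weighted_poset:
  assumes "cat_functor C FI Fo Fa" "conservative C FI Fa"
  shows "partial_order_on (iso_classes (weighted_cat C Fo Fa))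
    {(X, Y). X \<in> iso_classes (weighted_cat C Fo Fa) \<and> Y \<in> iso_classes (weighted_cat C Fo Fa) \<and>
       class_le (weighted_cat C Fo Fa) X Y}"
proof (rule category.iso_classes_partial_order[OF category_weighted_cat[OF assms(1)]])
  interpret cat_functor C FI Fo Fa by fact
  fix f g
  assume fg: "f \<in> Arr (weighted_cat C Fo Fa)" "g \<in> Arr (weighted_cat C Fo Fa)"
    "Dom (weighted_cat C Fo Fa) g = Cod (weighted_cat C Fo Fa) f"
    "Cod (weighted_cat C Fo Fa) g = Dom (weighted_cat C Fo Fa) f"
  obtain A \<alpha> \<phi> B \<beta> where f: "f = ((A, \<alpha>), \<phi>, (B, \<beta>))" by (cases f) auto
  obtain \<psi> where g: "g = ((B, \<beta>), \<psi>, (A, \<alpha>))"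
    using fg(3,4) f by (cases g) (auto simp: weighted_cat_sel)
  let ?f = "fi_fun (Fa \<phi>)" and ?g = "fi_fun (Fa \<psi>)"
  have F: "(A, \<alpha>) \<in> Obj (weighted_cat C Fo Fa)" "(B, \<beta>) \<in> Obj (weighted_cat C Fo Fa)"
    "\<phi> \<in> Arr C" "Dom C \<phi> = A" "Cod C \<phi> = B" "\<And>x. x \<in> Fo A \<Longrightarrow> \<alpha> x \<le> \<beta> (?f x)"
    "\<psi> \<in> Arr C" "Dom C \<psi> = B" "Cod C \<psi> = A" "\<And>x. x \<in> Fo B \<Longrightarrow> \<beta> x \<le> \<alpha> (?g x)"
    using fg(1,2) unfolding f g by (auto simp: weighted_cat_sel(2))
  have dom: "fi_dom (Fa \<phi>) = Fo A" "fi_cod (Fa \<phi>) = Fo B" "fi_dom (Fa \<psi>) = Fo B" "fi_cod (Fa \<psi>) = Fo A"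
    using F Dom_Fa Cod_Fa by (auto simp: FI_sel)
  have finj: "finite (Fo A)" "finite (Fo B)" "?f \<in> Fo A \<rightarrow>\<^sub>E Fo B" "inj_on ?f (Fo A)"
      "?g \<in> Fo B \<rightarrow>\<^sub>E Fo A" "inj_on ?g (Fo B)"
    using Fa_Arr[OF F(3)] Fa_Arr[OF F(7)] dom by (auto simp: FI_sel)
  have card: "card (Fo A) = card (Fo B)"
    using finj card_inj_on_le[of ?f "Fo A" "Fo B"] card_inj_on_le[of ?g "Fo B" "Fo A"]
    by (auto simp: PiE_def image_subset_iff Pi_iff)
  have img: "?f ` Fo A = Fo B" "?g ` Fo B = Fo A"
    using finj card by (intro card_subset_eq; auto simp: card_image)+
  have bij: "bij_betw ?f (Fo A) (Fo B)" using img finj by (simp add: bij_betw_def)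
  define h where "h = restrict (inv_into (Fo A) ?f) (Fo B)"
  have hf: "h (?f x) = x" if "x \<in> Fo A" for x
    using that finj img by (auto simp: h_def)
  have fh: "?f (h y) = y" "h y \<in> Fo A" if "y \<in> Fo B" for y
    using that img by (auto simp: h_def f_inv_into_f inv_into_into)
  have "FI_Arrow (Fo B) h (Fo A) \<in> Arr FI"
    using finj fh by (auto simp: FI_sel inj_on_def intro!: PiE_I) (simp_all add: h_def, metis)?
  moreover have "Comp FI (FI_Arrow (Fo B) h (Fo A)) (Fa \<phi>) = Ident FI (Fo A)"
    "Comp FI (Fa \<phi>) (FI_Arrow (Fo B) h (Fo A)) = Ident FI (Fo B)"
    using hf fh dom by (auto simp: FI_sel compose_def fun_eq_iff)
  ultimately have "is_iso FI (Fa \<phi>)"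
    unfolding is_iso_def using Fa_Arr[OF F(3)] dom
    by (intro conjI bexI[of _ "FI_Arrow (Fo B) h (Fo A)"]) (auto simp: FI_sel)
  then have "is_iso C \<phi>"
    using assms(2) F(3) unfolding conservative_def by blast
  then obtain \<theta> where t: "\<theta> \<in> Arr C" "Dom C \<theta> = B" "Cod C \<theta> = A"
      "Comp C \<theta> \<phi> = Ident C A" "Comp C \<phi> \<theta> = Ident C B"
    unfolding is_iso_def using F by auto
  have s1: "sum \<alpha> (Fo A) = (\<Sum>x\<in>Fo A. \<beta> (?f x))"
  proof (rule antisym)
    show "sum \<alpha> (Fo A) \<le> (\<Sum>x\<in>Fo A. \<beta> (?f x))" by (rule sum_mono) (rule F)
    have "(\<Sum>x\<in>Fo A. \<beta> (?f x)) = sum \<beta> (Fo B)" by (rule sum.reindex_bij_betw[OF bij])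
    also have "\<dots> \<le> (\<Sum>y\<in>Fo B. \<alpha> (?g y))" by (rule sum_mono) (rule F)
    also have "\<dots> = sum \<alpha> (Fo A)"
      by (rule sum.reindex_bij_betw) (use img finj in \<open>simp add: bij_betw_def\<close>)
    finally show "(\<Sum>x\<in>Fo A. \<beta> (?f x)) \<le> sum \<alpha> (Fo A)" .
  qed
  have eq: "\<alpha> x = \<beta> (?f x)" if "x \<in> Fo A" for x
    using sum_mono_inv[OF s1 F(6) that finj(1)] by simp
  have tf: "fi_fun (Fa \<theta>) y \<in> Fo A \<and> ?f (fi_fun (Fa \<theta>) y) = y" if "y \<in> Fo B" for y
  proof -
    have d: "fi_dom (Fa \<theta>) = Fo B" "fi_cod (Fa \<theta>) = Fo A"
      using Dom_Fa[OF t(1)] Cod_Fa[OF t(1)] t by (simp_all add: FI_sel)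
    have "Comp FI (Fa \<phi>) (Fa \<theta>) = Ident FI (Fo B)"
      using Fa_Comp[OF t(1) F(3)] Fa_Ident[of B] t F C.Cod_Obj by metis
    then have "compose (Fo B) ?f (fi_fun (Fa \<theta>)) y = y"
      using d that by (simp add: FI_sel)
    then show ?thesis
      using that Fa_Arr[OF t(1)] d by (auto simp: FI_sel compose_def)
  qed
  have "((B, \<beta>), \<theta>, (A, \<alpha>)) \<in> Arr (weighted_cat C Fo Fa)"
    using F t tf eq by (auto simp: weighted_cat_sel(2))
  then show "is_iso (weighted_cat C Fo Fa) f"
    unfolding is_iso_def using fg(1) t
    by (intro conjI bexI[of _ "((B, \<beta>), \<theta>, (A, \<alpha>))"]) (simp_all add: f weighted_cat_sel)
qed

end

theory Submission
  imports Defs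
begin

text \<open>This is a Groebner basis argument. Fix total orders on the sets \<open>Fo A\<close> that all morphisms
  preserve, and order the monomials in the variables \<open>Fo A\<close> lexicographically, the largest
  variable first. For each object this is a total well-order on monomials that is compatible with
  multiplication. A morphism \<open>\<phi>\<close> preserves it as well: the largest variable at which two renamed
  monomials differ is the image of the largest variable at which the original ones differ
  (\<open>lex_less_image\<close>). So \<open>\<phi>\<close> sends leading terms to leading terms.

  If an ascending chain of ideal systems does not stabilise, then for every index \<open>N\<close> there are a
  later index \<open>n\<close> and an object \<open>A\<close> at which the \<open>n\<close>-th ideal strictly contains the \<open>N\<close>-th one.
  Among the elements of the difference of these two ideals take one whose leading monomial
  is least. Repeat with \<open>n\<close> in place of \<open>N\<close>.
  Leading monomials are weightings on the chosen objects, so the well-quasi-order supplies two of these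
  elements, \<open>f\<close> at an earlier and \<open>g\<close> at a later step, and a morphism under which the leading
  monomial of \<open>f\<close> becomes a divisor of that of \<open>g\<close>. Subtracting from \<open>g\<close> a multiple of the image
  of \<open>f\<close> cancels the leading term of \<open>g\<close> (\<open>cancel_lead\<close>). The image of \<open>f\<close> already lies in the
  smaller ideal, so the difference is again outside that ideal, and its leading monomial is
  smaller. This contradicts the choice of \<open>g\<close>.\<close>

section \<open>The lexicographic order on monomials\<close>

definition mons :: "'x set \<Rightarrow> ('x \<Rightarrow>\<^sub>0 nat) set" where
  "mons S = {m. Poly_Mapping.keys m \<subseteq> S}"

definition lex_less :: "'x rel \<Rightarrow> ('x \<Rightarrow>\<^sub>0 nat) \<Rightarrow> ('x \<Rightarrow>\<^sub>0 nat) \<Rightarrow> bool" where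
  "lex_less r m n \<longleftrightarrow> (\<exists>x. Poly_Mapping.lookup m x < Poly_Mapping.lookup n x \<and>
     (\<forall>y. (x, y) \<in> r \<and> y \<noteq> x \<longrightarrow> Poly_Mapping.lookup m y = Poly_Mapping.lookup n y))"

lemma lookup_mons: "m \<in> mons S \<Longrightarrow> x \<notin> S \<Longrightarrow> Poly_Mapping.lookup m x = 0"
  by (auto simp: mons_def in_keys_iff)

lemma linear_order_greatest:
  assumes "finite T" "T \<noteq> {}" "T \<subseteq> S" "linear_order_on S r"
  shows "\<exists>s\<in>T. \<forall>x\<in>T. (x, s) \<in> r"
proof -
  have r: "refl_on S r" "trans r" "antisym r" "total_on S r"
    using assms(4) by (auto simp: linear_order_on_def partial_order_on_def preorder_on_def)
  have "\<exists>g\<in>T. \<forall>x\<in>T. x \<noteq> g \<longrightarrow> (x, g) \<in> r \<and> x \<noteq> g"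
  proof (rule Finite_Set.bex_greatest_element[OF assms(1,2)])
    show "transp_on T (\<lambda>x y. (x, y) \<in> r \<and> x \<noteq> y)"
      by (rule transp_onI) (metis r(2,3) transD antisymD)
    show "totalp_on T (\<lambda>x y. (x, y) \<in> r \<and> x \<noteq> y)"
      by (rule totalp_onI) (metis assms(3) r(4) subsetD total_on_def)
  qed
  then show ?thesis
    using r(1) assms(3) by (metis refl_onD subsetD)
qed

text \<open>Peel off the largest variable: among the monomials with the least exponent there, minimise
  over the remaining variables. The comparison is restricted to a set \<open>T\<close> of variables because
  peeling shrinks it.\<close>

lemma ex_lex_least_on:
  assumes "finite T" "T \<subseteq> S" "linear_order_on S r" "M \<noteq> {}"
  shows "\<exists>m\<in>M. \<forall>n\<in>M. (\<forall>x\<in>T. Poly_Mapping.lookup n x = Poly_Mapping.lookup m x) \<or>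
    (\<exists>x\<in>T. Poly_Mapping.lookup m x < (Poly_Mapping.lookup n x :: nat) \<and>
      (\<forall>y\<in>T. (x, y) \<in> r \<and> y \<noteq> x \<longrightarrow> Poly_Mapping.lookup m y = Poly_Mapping.lookup n y))"
  using assms
proof (induction T arbitrary: M rule: finite_psubset_induct)
  case (psubset T)
  have anti: "antisym r"
    using psubset.prems(2) by (auto simp: linear_order_on_def partial_order_on_def)
  show ?case
  proof (cases "T = {}")
    case True
    then show ?thesis using psubset.prems(3) by auto
  next
    case False
    obtain s where s: "s \<in> T" "\<And>x. x \<in> T \<Longrightarrow> (x, s) \<in> r"
      using linear_order_greatest[OF psubset.hyps(1) False psubset.prems(1,2)] by blast
    obtain m0 where m0: "m0 \<in> M"
      "\<And>n. n \<in> M \<Longrightarrow> Poly_Mapping.lookup m0 s \<le> Poly_Mapping.lookup n s"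
      using ex_has_least_nat[of "\<lambda>m. m \<in> M" _ "\<lambda>m. Poly_Mapping.lookup m s"] psubset.prems(3)
      by blast
    let ?M = "{m \<in> M. Poly_Mapping.lookup m s = Poly_Mapping.lookup m0 s}"
    have "T - {s} \<subset> T" "T - {s} \<subseteq> S" "?M \<noteq> {}"
      using s m0 psubset.prems by auto
    from psubset.IH[OF this(1,2) psubset.prems(2) this(3)]
    obtain m where m: "m \<in> ?M" and least: "\<And>n. n \<in> ?M \<Longrightarrow>
      (\<forall>x\<in>T - {s}. Poly_Mapping.lookup n x = Poly_Mapping.lookup m x) \<or>
      (\<exists>x\<in>T - {s}. Poly_Mapping.lookup m x < Poly_Mapping.lookup n x \<and>
        (\<forall>y\<in>T - {s}. (x, y) \<in> r \<and> y \<noteq> x \<longrightarrow>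
          Poly_Mapping.lookup m y = Poly_Mapping.lookup n y))"
      by blast
    show ?thesis
    proof (intro bexI ballI)
      show "m \<in> M" using m by simp
      fix n assume n: "n \<in> M"
      show "(\<forall>x\<in>T. Poly_Mapping.lookup n x = Poly_Mapping.lookup m x) \<or>
        (\<exists>x\<in>T. Poly_Mapping.lookup m x < Poly_Mapping.lookup n x \<and>
          (\<forall>y\<in>T. (x, y) \<in> r \<and> y \<noteq> x \<longrightarrow> Poly_Mapping.lookup m y = Poly_Mapping.lookup n y))"
      proof (cases "Poly_Mapping.lookup n s = Poly_Mapping.lookup m0 s")
        case True
        then have ms: "Poly_Mapping.lookup m s = Poly_Mapping.lookup n s" and "n \<in> ?M"
          using m n by auto
        from least[OF this(2)] show ?thesis
          using ms by (metis Diff_iff singletonD)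
      next
        case False
        then have "Poly_Mapping.lookup m s < Poly_Mapping.lookup n s"
          using m m0(2)[OF n] by simp
        moreover have "\<forall>y\<in>T. (s, y) \<in> r \<and> y \<noteq> s \<longrightarrow>
            Poly_Mapping.lookup m y = Poly_Mapping.lookup n y"
          using s anti by (metis antisymD)
        ultimately show ?thesis using s(1) by blast
      qed
    qed
  qed
qed

lemma ex_lex_least:
  assumes "finite S" "linear_order_on S r" "M \<noteq> {}" "M \<subseteq> mons S"
  shows "\<exists>m\<in>M. \<forall>n\<in>M. n = m \<or> lex_less r m n"
proof -
  obtain m where m: "m \<in> M" and least: "\<And>n. n \<in> M \<Longrightarrow>
      (\<forall>x\<in>S. Poly_Mapping.lookup n x = Poly_Mapping.lookup m x) \<or>
      (\<exists>x\<in>S. Poly_Mapping.lookup m x < Poly_Mapping.lookup n x \<and>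
        (\<forall>y\<in>S. (x, y) \<in> r \<and> y \<noteq> x \<longrightarrow> Poly_Mapping.lookup m y = Poly_Mapping.lookup n y))"
    using ex_lex_least_on[OF assms(1) order_refl assms(2,3)] by blast
  have "n = m \<or> lex_less r m n" if n: "n \<in> M" for n
  proof -
    have off: "Poly_Mapping.lookup n x = Poly_Mapping.lookup m x" if "x \<notin> S" for x
      using that n m assms(4) lookup_mons by (metis subsetD)
    have "n = m" if "\<forall>x\<in>S. Poly_Mapping.lookup n x = Poly_Mapping.lookup m x"
      using that off by (intro poly_mapping_eqI) blast
    then show ?thesis
      using least[OF n] off unfolding lex_less_def by metis
  qed
  then show ?thesis using m by blast
qed

lemma lex_less_total:
  assumes "finite S" "linear_order_on S r" "m \<in> mons S" "n \<in> mons S" "m \<noteq> n"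
  shows "lex_less r m n \<or> lex_less r n m"
  using ex_lex_least[of S r "{m, n}"] assms by auto

lemma lex_less_trans:
  assumes "linear_order_on S r" "n \<in> mons S" "p \<in> mons S"
    and "lex_less r m n" "lex_less r n p"
  shows "lex_less r m p"
proof -
  have r: "trans r" "antisym r" "total_on S r"
    using assms(1) by (auto simp: linear_order_on_def partial_order_on_def preorder_on_def)
  obtain x where x: "Poly_Mapping.lookup m x < Poly_Mapping.lookup n x"
    "\<And>y. (x, y) \<in> r \<Longrightarrow> y \<noteq> x \<Longrightarrow> Poly_Mapping.lookup m y = Poly_Mapping.lookup n y"
    using assms(4) unfolding lex_less_def by blast
  obtain z where z: "Poly_Mapping.lookup n z < Poly_Mapping.lookup p z"
    "\<And>y. (z, y) \<in> r \<Longrightarrow> y \<noteq> z \<Longrightarrow> Poly_Mapping.lookup n y = Poly_Mapping.lookup p y"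
    using assms(5) unfolding lex_less_def by blast
  have xz: "x \<in> S" "z \<in> S"
    using x(1) z(1) lookup_mons assms(2,3) by (metis not_less0)+
  \<comment> \<open>The larger of the two deciding variables decides between \<open>m\<close> and \<open>p\<close>.\<close>
  consider "x = z" | "x \<noteq> z" "(x, z) \<in> r" | "x \<noteq> z" "(z, x) \<in> r"
    using xz r(3) by (metis total_on_def)
  then show ?thesis
  proof cases
    case 1
    then show ?thesis
      using x z unfolding lex_less_def by (intro exI[of _ x]) auto
  next
    case 2
    have "Poly_Mapping.lookup m y = Poly_Mapping.lookup p y" if "(z, y) \<in> r" "y \<noteq> z" for y
      using that x(2)[of y] z(2)[of y] 2 r by (metis transD antisymD)
    then show ?thesis
      using z(1) x(2)[of z] 2 unfolding lex_less_def by (intro exI[of _ z]) auto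
  next
    case 3
    have "Poly_Mapping.lookup m y = Poly_Mapping.lookup p y" if "(x, y) \<in> r" "y \<noteq> x" for y
      using that x(2)[of y] z(2)[of y] 3 r by (metis transD antisymD)
    then show ?thesis
      using x(1) z(2)[of x] 3 unfolding lex_less_def by (intro exI[of _ x]) auto
  qed
qed

lemma lex_less_irrefl: "\<not> lex_less r m m"
  by (simp add: lex_less_def)

section \<open>Leading monomials\<close>

definition is_lead :: "'x rel \<Rightarrow> ('x, 'k::comm_ring_1) mpoly \<Rightarrow> ('x \<Rightarrow>\<^sub>0 nat) \<Rightarrow> bool" where
  "is_lead r f m \<longleftrightarrow> m \<in> Poly_Mapping.keys f \<and>
     (\<forall>n \<in> Poly_Mapping.keys f. n \<noteq> m \<longrightarrow> lex_less r n m)"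

lemma ex_lead:
  fixes f :: "('x, 'k::comm_ring_1) mpoly"
  assumes "finite S" "linear_order_on S r" "f \<in> carrier (poly_ring S)" "f \<noteq> 0"
  shows "\<exists>m. is_lead r f m"
proof -
  have sub: "Poly_Mapping.keys f \<subseteq> mons S"
    using assms(3) by (auto simp: poly_ring_sel mons_def)
  have "\<exists>g\<in>Poly_Mapping.keys f. \<forall>x\<in>Poly_Mapping.keys f. x \<noteq> g \<longrightarrow> lex_less r x g"
  proof (rule Finite_Set.bex_greatest_element)
    show "transp_on (Poly_Mapping.keys f) (lex_less r)"
      by (rule transp_onI) (meson lex_less_trans[OF assms(2)] sub subsetD)
    show "totalp_on (Poly_Mapping.keys f) (lex_less r)"
      by (rule totalp_onI) (meson lex_less_total[OF assms(1,2)] sub subsetD)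
  qed (use assms(4) in simp_all)
  then show ?thesis unfolding is_lead_def by blast
qed

section \<open>Renaming variables in monomials\<close>

definition push_mon :: "('x \<Rightarrow> 'x) \<Rightarrow> ('x \<Rightarrow>\<^sub>0 nat) \<Rightarrow> ('x \<Rightarrow>\<^sub>0 nat)" where
  "push_mon h m = (\<Sum>i \<in> Poly_Mapping.keys m.
     Poly_Mapping.single (h i) (Poly_Mapping.lookup m i))"

lemma lookup_push_mon:
  assumes "inj_on h S" "m \<in> mons S" "x \<in> S"
  shows "Poly_Mapping.lookup (push_mon h m) (h x) = Poly_Mapping.lookup m x"
proof -
  have "Poly_Mapping.lookup (push_mon h m) (h x) =
      (\<Sum>i \<in> Poly_Mapping.keys m. if i = x then Poly_Mapping.lookup m i else 0)"
    unfolding push_mon_def lookup_sum lookup_single when_def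
    using assms by (intro sum.cong) (auto simp: mons_def inj_on_def)
  then show ?thesis by (auto simp: in_keys_iff)
qed

lemma lookup_push_mon_off:
  assumes "m \<in> mons S" "y \<notin> h ` S"
  shows "Poly_Mapping.lookup (push_mon h m) y = 0"
  using assms by (auto simp: push_mon_def lookup_sum lookup_single when_def mons_def)

lemma rename_mon_eq: "rename_mon h m = Poly_Mapping.single (push_mon h m) 1"
proof -
  have pow: "pvar x ^ n = Poly_Mapping.single (Poly_Mapping.single x n) 1" for x :: 'a and n
    by (induction n) (simp_all add: pvar_def mult_single flip: single_add)
  have "(\<Prod>i\<in>T. Poly_Mapping.single (g i) 1) = Poly_Mapping.single (\<Sum>i\<in>T. g i) (1::'b)"
    for T and g :: "'a \<Rightarrow> 'a \<Rightarrow>\<^sub>0 nat"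
    by (induction T rule: infinite_finite_induct) (simp_all add: mult_single)
  then show ?thesis by (simp add: rename_mon_def push_mon_def pow)
qed

lemma monomial_mult_rename_vars:
  "Poly_Mapping.single t d * rename_vars h f =
     (\<Sum>m \<in> Poly_Mapping.keys f.
        Poly_Mapping.single (t + push_mon h m) (d * Poly_Mapping.lookup f m))"
  by (simp add: rename_vars_def pconst_def sum_distrib_left mult_single
        rename_mon_def[symmetric] rename_mon_eq)

lemma inj_on_push_mon:
  assumes "inj_on h S"
  shows "inj_on (push_mon h) (mons S)"
proof (rule inj_onI, rule poly_mapping_eqI)
  fix m n x assume "m \<in> mons S" "n \<in> mons S" "push_mon h m = push_mon h n"
  then show "Poly_Mapping.lookup m x = Poly_Mapping.lookup n x"
    using lookup_push_mon[OF assms] lookup_mons by metis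
qed

text \<open>Variables outside \<open>h ` S\<close> do not occur in renamed monomials, and on \<open>S\<close> the map \<open>h\<close> reflects
  the order, because it is injective and preserves an order that is total. So the deciding
  variable \<open>x\<close> is replaced by \<open>h x\<close>. The common factor \<open>t\<close> adds the same exponents on both sides.\<close>

lemma lex_less_image:
  assumes "linear_order_on S r" "antisym q" "inj_on h S"
    and mono: "\<And>x y. (x, y) \<in> r \<Longrightarrow> (h x, h y) \<in> q"
    and mn: "m \<in> mons S" "n \<in> mons S" and less: "lex_less r m n"
  shows "lex_less q (t + push_mon h m) (t + push_mon h n)"
proof -
  have tot: "total_on S r" using assms(1) by (simp add: linear_order_on_def)
  obtain x where x: "Poly_Mapping.lookup m x < Poly_Mapping.lookup n x"
    "\<And>y. (x, y) \<in> r \<Longrightarrow> y \<noteq> x \<Longrightarrow> Poly_Mapping.lookup m y = Poly_Mapping.lookup n y"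
    using less unfolding lex_less_def by blast
  have xS: "x \<in> S" using x(1) lookup_mons mn by (metis not_less0)
  note push = lookup_push_mon[OF assms(3)]
  have "Poly_Mapping.lookup (push_mon h m) y = Poly_Mapping.lookup (push_mon h n) y"
    if y: "(h x, y) \<in> q" "y \<noteq> h x" for y
  proof (cases "y \<in> h ` S")
    case True
    then obtain z where z: "y = h z" "z \<in> S" by blast
    then have "(x, z) \<in> r"
      using y xS tot mono assms(2) by (metis total_on_def antisymD)
    then show ?thesis using z x(2)[of z] y(2) push mn by auto
  qed (simp add: lookup_push_mon_off[OF mn(1)] lookup_push_mon_off[OF mn(2)])
  moreover have "Poly_Mapping.lookup (push_mon h m) (h x) <
      Poly_Mapping.lookup (push_mon h n) (h x)"
    using x(1) push mn xS by simp
  ultimately show ?thesis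
    unfolding lex_less_def by (intro exI[of _ "h x"]) (simp add: lookup_add)
qed

text \<open>The multiplier \<open>c\<close> is the quotient of the two leading monomials, with the scalar that makes
  the leading coefficients cancel. All other terms stay below \<open>b\<close> because renaming and
  multiplication by a monomial preserve the order. The result has no term at all when the two
  polynomials cancel completely, so the conclusion is about every remaining monomial.\<close>

lemma cancel_lead:
  fixes f g :: "('x, 'k::field) mpoly"
  assumes "linear_order_on S r" "antisym q" "inj_on h S"
    and mono: "\<And>x y. (x, y) \<in> r \<Longrightarrow> (h x, h y) \<in> q"
    and f: "f \<in> carrier (poly_ring S)" "is_lead r f a"
    and g: "g \<in> carrier (poly_ring T)" "is_lead q g b"
    and dvd: "\<And>x. x \<in> S \<Longrightarrow> Poly_Mapping.lookup a x \<le> Poly_Mapping.lookup b (h x)"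
  shows "\<exists>c \<in> carrier (poly_ring T). \<forall>n \<in> Poly_Mapping.keys (g + c * rename_vars h f). lex_less q n b"
proof -
  have fS: "Poly_Mapping.keys f \<subseteq> mons S" using f(1) by (auto simp: poly_ring_sel mons_def)
  have aS: "a \<in> mons S" and bT: "b \<in> mons T"
    using f g by (auto simp: poly_ring_sel mons_def is_lead_def)
  define t where "t = b - push_mon h a"
  define d where "d = - (Poly_Mapping.lookup g b / Poly_Mapping.lookup f a)"
  let ?\<sigma> = "\<lambda>m. t + push_mon h m"
  let ?c = "Poly_Mapping.single t d"
  have \<sigma>a: "?\<sigma> a = b"
  proof (rule poly_mapping_eqI)
    fix y
    have "Poly_Mapping.lookup (push_mon h a) y \<le> Poly_Mapping.lookup b y"
      using lookup_push_mon[OF assms(3) aS] lookup_push_mon_off[OF aS] dvd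
      by (metis imageE zero_le)
    then show "Poly_Mapping.lookup (?\<sigma> a) y = Poly_Mapping.lookup b y"
      by (simp add: t_def lookup_add lookup_minus)
  qed
  have "Poly_Mapping.keys t \<subseteq> T"
    using bT by (auto simp: t_def mons_def in_keys_iff lookup_minus)
  then have c: "?c \<in> carrier (poly_ring T)" by (simp add: poly_ring_sel)
  have inj: "inj_on ?\<sigma> (Poly_Mapping.keys f)"
    using inj_on_subset[OF inj_on_push_mon[OF assms(3)] fS] by (simp add: inj_on_def)
  have lookup: "Poly_Mapping.lookup (?c * rename_vars h f) n =
      (\<Sum>m \<in> Poly_Mapping.keys f. if ?\<sigma> m = n then d * Poly_Mapping.lookup f m else 0)" for n
    by (simp add: monomial_mult_rename_vars lookup_sum lookup_single when_def)
  have af: "a \<in> Poly_Mapping.keys f" using f(2) by (simp add: is_lead_def)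
  have "Poly_Mapping.lookup (?c * rename_vars h f) b = d * Poly_Mapping.lookup f a"
  proof -
    have "Poly_Mapping.lookup (?c * rename_vars h f) b =
      (\<Sum>m \<in> Poly_Mapping.keys f. if m = a then d * Poly_Mapping.lookup f m else 0)"
      unfolding lookup
    proof (intro sum.cong refl)
      fix m assume "m \<in> Poly_Mapping.keys f"
      then have "?\<sigma> m = b \<longleftrightarrow> m = a"
        using inj_onD[OF inj _ _ af, of m] \<sigma>a by auto
      then show "(if ?\<sigma> m = b then d * Poly_Mapping.lookup f m else 0) =
          (if m = a then d * Poly_Mapping.lookup f m else 0)" by simp
    qed
    then show ?thesis using af by simp
  qed
  then have b: "b \<notin> Poly_Mapping.keys (g + ?c * rename_vars h f)"
    using af by (simp add: in_keys_iff lookup_add d_def)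
  have "lex_less q n b" if n: "n \<in> Poly_Mapping.keys (g + ?c * rename_vars h f)" for n
  proof -
    have nb: "n \<noteq> b" using n b by blast
    consider "n \<in> Poly_Mapping.keys g" | "n \<in> Poly_Mapping.keys (?c * rename_vars h f)"
      using subsetD[OF keys_add n] by blast
    then show ?thesis
    proof cases
      case 1
      then show ?thesis using g(2) nb by (simp add: is_lead_def)
    next
      case 2
      then have "(\<Sum>m \<in> Poly_Mapping.keys f.
          if ?\<sigma> m = n then d * Poly_Mapping.lookup f m else 0) \<noteq> 0"
        by (simp only: in_keys_iff[of n] lookup not_False_eq_True)
      then obtain m where m: "m \<in> Poly_Mapping.keys f" "?\<sigma> m = n"
        by (rule sum.not_neutral_contains_not_neutral) meson
      then have "lex_less r m a" using f(2) nb \<sigma>a by (auto simp: is_lead_def)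
      then have "lex_less q (?\<sigma> m) (?\<sigma> a)"
        using lex_less_image[OF assms(1-3) mono _ aS] m fS by blast
      then show ?thesis using m(2) \<sigma>a by simp
    qed
  qed
  then show ?thesis using c by blast
qed

section \<open>Ascending chains of ideal systems\<close>

text \<open>Composing with the isomorphisms to and from the representatives moves a morphism between
  them to one between the given objects.\<close>

lemma (in category) class_le_classes:
  assumes "A \<in> Obj C" "B \<in> Obj C"
    and le: "class_le C ({(A, B). A \<in> Obj C \<and> B \<in> Obj C \<and> isomorphic C A B} `` {A})
      ({(A, B). A \<in> Obj C \<and> B \<in> Obj C \<and> isomorphic C A B} `` {B})"
  shows "\<exists>f \<in> Arr C. Dom C f = A \<and> Cod C f = B"
proof -
  obtain f where f: "f \<in> Arr C" "isomorphic C A (Dom C f)" "isomorphic C B (Cod C f)"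
    using le unfolding class_le_def by auto
  obtain u where u: "u \<in> Arr C" "Dom C u = A" "Cod C u = Dom C f"
    using f(2) unfolding isomorphic_def is_iso_def by blast
  obtain v where v: "v \<in> Arr C" "Dom C v = Cod C f" "Cod C v = B"
    using isomorphic_sym[OF f(3)] unfolding isomorphic_def is_iso_def by blast
  show ?thesis
    by (rule bexI[of _ "Comp C v (Comp C f u)"])
      (use f u v in \<open>simp_all add: Comp_Arr Dom_Comp Cod_Comp\<close>)
qed

text \<open>Exponent vectors, restricted to the underlying sets, are weightings. This turns the
  well-quasi-order on isomorphism classes into the divisibility between leading monomials that
  \<open>cancel_lead\<close> requires.\<close>

lemma wqo_monomials:
  fixes C :: "('o, 'm) cat" and Fo :: "'o \<Rightarrow> 'x set" and Fa :: "'m \<Rightarrow> 'x fi_arrow"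
    and m :: "nat \<Rightarrow> 'x \<Rightarrow>\<^sub>0 nat"
  assumes "cat_functor C FI Fo Fa"
    and wqo: "wqo_on (iso_classes (weighted_cat C Fo Fa)) (class_le (weighted_cat C Fo Fa))"
    and A: "\<And>k. A k \<in> Obj C"
  shows "\<exists>i j \<phi>. i < j \<and> \<phi> \<in> Arr C \<and> Dom C \<phi> = A i \<and> Cod C \<phi> = A j \<and>
    (\<forall>x \<in> Fo (A i). Poly_Mapping.lookup (m i) x \<le> Poly_Mapping.lookup (m j) (fi_fun (Fa \<phi>) x))"
proof -
  interpret cat_functor C FI Fo Fa by fact
  let ?W = "weighted_cat C Fo Fa"
  interpret W: category ?W by (rule category_weighted_cat) fact
  define w where "w k = (A k, restrict (Poly_Mapping.lookup (m k)) (Fo (A k)))" for k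
  let ?r = "{(a, b). a \<in> Obj ?W \<and> b \<in> Obj ?W \<and> isomorphic ?W a b}"
  have w: "w k \<in> Obj ?W" for k
    using A[of k] by (auto simp: w_def weighted_cat_sel)
  then have "\<And>k. ?r `` {w k} \<in> iso_classes ?W"
    unfolding iso_classes_def by (rule quotientI)
  then obtain i j where ij: "i < j" "class_le ?W (?r `` {w i}) (?r `` {w j})"
    using wqo unfolding wqo_on_def by (auto dest!: spec[of _ "\<lambda>k. ?r `` {w k}"])
  obtain e where e: "e \<in> Arr ?W" "Dom ?W e = w i" "Cod ?W e = w j"
    using W.class_le_classes[OF w w ij(2)] by blast
  obtain \<phi> where "e = (w i, \<phi>, w j)"
    using e(2,3) by (cases e) (auto simp: weighted_cat_sel)
  then have \<phi>: "\<phi> \<in> Arr C" "Dom C \<phi> = A i" "Cod C \<phi> = A j"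
    "\<And>x. x \<in> Fo (A i) \<Longrightarrow> snd (w i) x \<le> snd (w j) (fi_fun (Fa \<phi>) x)"
    using e(1) by (auto simp: weighted_cat_sel(2) w_def)
  have "fi_fun (Fa \<phi>) x \<in> Fo (A j)" if "x \<in> Fo (A i)" for x
    using Fa_Arr[OF \<phi>(1)] Dom_Fa[OF \<phi>(1)] Cod_Fa[OF \<phi>(1)] \<phi>(2,3) that by (auto simp: FI_sel)
  then have "\<forall>x \<in> Fo (A i). Poly_Mapping.lookup (m i) x \<le>
      Poly_Mapping.lookup (m j) (fi_fun (Fa \<phi>) x)"
    using \<phi>(4) by (force simp: w_def)
  then show ?thesis using ij(1) \<phi> by blast
qed

theorem theorem1p4:
  fixes C :: "('o, 'm) cat"
    and Fo :: "'o \<Rightarrow> 'x set"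
    and Fa :: "'m \<Rightarrow> 'x fi_arrow"
  assumes "category C"
    and "cat_functor C FI Fo Fa"
    and "faithful C Fa"
    and "conservative C FI Fa"
    and "orderable C Fo Fa"
    and "wqo_on (iso_classes (weighted_cat C Fo Fa)) (class_le (weighted_cat C Fo Fa))"
  shows "noetherian C (R_obj Fo :: 'o \<Rightarrow> ('x, 'k::field) mpoly ring) (R_map Fa)"
proof -
  interpret cat_functor C FI Fo Fa by fact
  obtain L where L: "\<And>A. A \<in> Obj C \<Longrightarrow> linear_order_on (Fo A) (L A)"
    and L_mono: "\<And>\<phi> x y. \<phi> \<in> Arr C \<Longrightarrow> (x, y) \<in> L (Dom C \<phi>) \<Longrightarrow>
      (fi_fun (Fa \<phi>) x, fi_fun (Fa \<phi>) y) \<in> L (Cod C \<phi>)"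
    using assms(5) unfolding orderable_def by blast
  have fin: "finite (Fo A)" if "A \<in> Obj C" for A
    using Fo_Obj[OF that] by (simp add: FI_sel)
  show ?thesis
    unfolding noetherian_def
  proof (intro allI impI, rule ccontr)
    fix I :: "nat \<Rightarrow> 'o \<Rightarrow> ('x, 'k) mpoly set"
    assume chain: "(\<forall>n. ideal_system C (R_obj Fo) (R_map Fa) (I n)) \<and>
        (\<forall>n. \<forall>A\<in>Obj C. I n A \<subseteq> I (Suc n) A)"
      and unstable: "\<nexists>N. \<forall>n\<ge>N. \<forall>A\<in>Obj C. I n A = I N A"
    have ideal: "ideal (I n A) (poly_ring (Fo A))" if "A \<in> Obj C" for n A
      using chain that by (auto simp: ideal_system_def R_obj_def)
    have map: "rename_vars (fi_fun (Fa \<phi>)) f \<in> I n (Cod C \<phi>)"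
      if "\<phi> \<in> Arr C" "f \<in> I n (Dom C \<phi>)" for n \<phi> f
      using chain that unfolding ideal_system_def R_map_def by blast
    have mono: "I n A \<subseteq> I n' A" if "A \<in> Obj C" "n \<le> n'" for n n' A
      by (rule lift_Suc_mono_le[of "\<lambda>n. I n A"]) (use chain that in auto)
    have gap: "\<exists>n A f m. N \<le> n \<and> A \<in> Obj C \<and> f \<in> I n A - I N A \<and> is_lead (L A) f m \<and>
        (\<forall>f' m'. f' \<in> I n A - I N A \<and> is_lead (L A) f' m' \<longrightarrow> m' = m \<or> lex_less (L A) m m')"
      for N
    proof -
      obtain n A where nA: "N \<le> n" "A \<in> Obj C" "I n A \<noteq> I N A"
        using unstable by blast
      then obtain f0 where f0: "f0 \<in> I n A - I N A" using mono[of A N n] by blast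
      have carr: "f \<in> carrier (poly_ring (Fo A))" if "f \<in> I n A" for f
        using ideal.Icarr[OF ideal[OF nA(2)] that] .
      have "f0 \<noteq> 0"
        using f0 additive_subgroup.zero_closed[OF ideal.axioms(1)[OF ideal[OF nA(2)]]]
        by (auto simp: poly_ring_sel)
      then obtain m0 where m0: "is_lead (L A) f0 m0"
        using ex_lead[OF fin[OF nA(2)] L[OF nA(2)] carr] f0 by blast
      let ?M = "{m. \<exists>f \<in> I n A - I N A. is_lead (L A) f m}"
      have "?M \<subseteq> mons (Fo A)"
        using carr by (fastforce simp: is_lead_def mons_def poly_ring_sel)
      moreover have "?M \<noteq> {}" using f0 m0 by blast
      ultimately obtain m where m: "m \<in> ?M" "\<forall>m' \<in> ?M. m' = m \<or> lex_less (L A) m m'"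
        using ex_lex_least[OF fin[OF nA(2)] L[OF nA(2)], of ?M] by blast
      then obtain f where "f \<in> I n A - I N A" "is_lead (L A) f m" by blast
      then show ?thesis using nA(1,2) m(2) by blast
    qed
    obtain p A f m where gaps: "\<And>N. N \<le> p N" "\<And>N. A N \<in> Obj C"
      "\<And>N. f N \<in> I (p N) (A N) - I N (A N)" "\<And>N. is_lead (L (A N)) (f N) (m N)"
      and least: "\<And>N f' m'. f' \<in> I (p N) (A N) - I N (A N) \<Longrightarrow> is_lead (L (A N)) f' m' \<Longrightarrow>
        m' = m N \<or> lex_less (L (A N)) (m N) m'"
      using gap by metis
    \<comment> \<open>Iterating \<open>p\<close> spaces the steps so that \<open>f (s i)\<close> lies in the \<open>s j\<close>-th member when \<open>i < j\<close>.\<close>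
    define s where "s k = (p ^^ k) 0" for k
    have s_mono: "s i \<le> s j" if "i \<le> j" for i j
      by (rule lift_Suc_mono_le[of s]) (use that in \<open>simp_all add: s_def gaps(1)\<close>)
    obtain i j \<phi> where ij: "i < j" and \<phi>: "\<phi> \<in> Arr C" "Dom C \<phi> = A (s i)" "Cod C \<phi> = A (s j)"
      and dvd: "\<And>x. x \<in> Fo (A (s i)) \<Longrightarrow> Poly_Mapping.lookup (m (s i)) x \<le>
        Poly_Mapping.lookup (m (s j)) (fi_fun (Fa \<phi>) x)"
      using wqo_monomials[OF assms(2,6), of "\<lambda>k. A (s k)" "\<lambda>k. m (s k)"] gaps(2) by blast
    let ?A = "A (s i)" and ?B = "A (s j)" and ?h = "fi_fun (Fa \<phi>)"
    let ?J = "I (s j) ?B" and ?J' = "I (p (s j)) ?B"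
    have A: "?A \<in> Obj C" and B: "?B \<in> Obj C" by (rule gaps(2))+
    have h: "inj_on ?h (Fo ?A)"
      using Fa_Arr[OF \<phi>(1)] Dom_Fa[OF \<phi>(1)] \<phi>(2) by (auto simp: FI_sel)
    have anti: "antisym (L ?B)"
      using L[OF B] by (simp add: linear_order_on_def partial_order_on_def)
    have carr_i: "f (s i) \<in> carrier (poly_ring (Fo ?A))"
      using ideal.Icarr[OF ideal[OF A]] gaps(3) by blast
    have carr_j: "f (s j) \<in> carrier (poly_ring (Fo ?B))"
      using ideal.Icarr[OF ideal[OF B]] gaps(3) by blast
    obtain c where c: "c \<in> carrier (poly_ring (Fo ?B))"
      and less: "\<And>n. n \<in> Poly_Mapping.keys (f (s j) + c * rename_vars ?h (f (s i))) \<Longrightarrow>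
        lex_less (L ?B) n (m (s j))"
      using cancel_lead[OF L[OF A] anti h _ carr_i gaps(4) carr_j gaps(4) dvd]
        L_mono[OF \<phi>(1)] \<phi>(2,3) by metis
    define g where "g = c * rename_vars ?h (f (s i))"
    have "p (s i) \<le> s j" using s_mono[of "Suc i" j] ij by (simp add: s_def)
    then have "f (s i) \<in> I (s j) ?A" using gaps(3) mono[OF A] by blast
    then have "rename_vars ?h (f (s i)) \<in> ?J" using map[OF \<phi>(1)] \<phi>(2,3) by metis
    then have g: "g \<in> ?J"
      using ideal.I_l_closed[OF ideal[OF B] _ c] by (simp add: g_def poly_ring_sel(2))
    have add: "u + v \<in> I n ?B" if "u \<in> I n ?B" "v \<in> I n ?B" for n u v
      using additive_subgroup.a_closed[OF ideal.axioms(1)[OF ideal[OF B]] that]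
      by (simp add: poly_ring_sel(5))
    have "f (s j) + g \<notin> ?J"
    proof
      assume sum: "f (s j) + g \<in> ?J"
      have "- 1 \<in> carrier (poly_ring (Fo ?B) :: ('x, 'k) mpoly ring)"
        by (simp add: poly_ring_sel)
      then have "- g \<in> ?J"
        using ideal.I_l_closed[OF ideal[OF B] g, of "- 1"] by (simp add: poly_ring_sel(2))
      then have "f (s j) \<in> ?J" using add[OF sum] by fastforce
      then show False using gaps(3) by blast
    qed
    moreover have "f (s j) + g \<in> ?J'"
      using add[of "f (s j)" "p (s j)" g] g gaps(3) mono[OF B gaps(1)] by blast
    ultimately have diff: "f (s j) + g \<in> ?J' - ?J" by blast
    have "f (s j) + g \<noteq> 0"
      using diff additive_subgroup.zero_closed[OF ideal.axioms(1)[OF ideal[OF B]]]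
      by (auto simp: poly_ring_sel)
    then obtain m' where m': "is_lead (L ?B) (f (s j) + g) m'"
      using ex_lead[OF fin[OF B] L[OF B] ideal.Icarr[OF ideal[OF B]]] diff by blast
    then have "lex_less (L ?B) m' (m (s j))"
      using less by (simp add: is_lead_def g_def)
    moreover have "m' = m (s j) \<or> lex_less (L ?B) (m (s j)) m'"
      using least[OF diff m'] .
    moreover have "m' \<in> mons (Fo ?B)" "m (s j) \<in> mons (Fo ?B)"
      using m' gaps(4)[of "s j"] carr_j ideal.Icarr[OF ideal[OF B]] diff
      by (fastforce simp: is_lead_def mons_def poly_ring_sel)+
    ultimately show False
      using lex_less_trans[OF L[OF B]] lex_less_irrefl by metis
  qed
qed

end
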